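(* Let $l,T>0$, let $N\ge2$, $j_0\ge1$ be integers, $h=l/N$, $\tau=T/j_0$, $x_i=ih$, $t_j=j\tau$. Let $\alpha:(0,l)\to(0,1)$ be continuous, $\alpha_i=\alpha(x_i)$ for $i=1,\dots,N-1$, and let $k,q,f$ be functions on $\bar Q_T=[0,l]\times[0,T]$ with $k\ge c_1>0$ and $q\ge0$. Let $0\le\sigma\le1$. Consider the difference scheme for the grid function $y=y_i^j$ ($0\le i\le N$, $0\le j\le j_0$): $$\Delta_{0t_j}^{\alpha_i}y=\Lambda\left(\sigma y^{j+1}+(1-\sigma)y^j\right)+\varphi,\quad i=1,\dots,N-1,\ j=0,\dots,j_0-1,$$ $$y_0^j=0,\quad y_N^j=0,\quad j=0,\dots,j_0,\qquad y_i^0=u_0(x_i),\quad i=0,\dots,N,$$ with $\Lambda$, $\varphi$, $\Delta_{0t_j}^{\alpha_i}$ as defined in the context. If $$\sigma\ge\frac{1}{3-2^{1-\min_i\alpha_i}},$$ then the scheme is absolutely stable and its solution satisfies, for every $j=0,\dots,j_0-1$, the a priori estimate $$\left(\frac{1}{\Gamma(2-\alpha_i)},\ \sum_{j'=0}^{j}\left(t_{j-j'+1}^{1-\alpha_i}-t_{j-j'}^{1-\alpha_i}\right)(y^{j'+1})^2\right)+c_1\sum_{j'=0}^{j}\left\|\sigma y_{\bar x}^{j'+1}+(1-\sigma)y_{\bar x}^{j'}\right]|_0^2\,\tau$$ $$\le\frac{l^2}{2c_1}\sum_{j'=0}^{j}\|\varphi^{j'}\|_0^2\,\tau+\left(\frac{t_{j+1}^{1-\alpha_i}}{\Gamma(2-\alpha_i)},\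 u_0^2(x_i)\right).$$
   Context: Notation: $y_t^s=(y^{s+1}-y^s)/\tau$; $y_{\bar x,i}=(y_i-y_{i-1})/h$; $y_{x,i}=(y_{i+1}-y_i)/h$. The discrete Caputo derivative of order $\alpha_i$ is $$\Delta_{0t_j}^{\alpha_i}y=\frac{1}{\Gamma(2-\alpha_i)}\sum_{s=0}^{j}\left(t_{j-s+1}^{1-\alpha_i}-t_{j-s}^{1-\alpha_i}\right)y_t^s .$$ At time level $j$ put $\bar t=t_{j+1/2}=(j+\tfrac12)\tau$, $a_i=k(x_{i-1/2},\bar t)$ with $x_{i-1/2}=(i-\tfrac12)h$, $d_i=q(x_i,\bar t)$, $\varphi_i^j=f(x_i,\bar t)$, and $\Lambda y=(ay_{\bar x})_x-dy$, i.e. $(\Lambda y)_i=\frac{1}{h}\left(a_{i+1}y_{\bar x,i+1}-a_iy_{\bar x,i}\right)-d_iy_i$. Inner products and norms: $(y,v)=\sum_{i=1}^{N-1}y_iv_ih$, $(y,v]=\sum_{i=1}^{N}y_iv_ih$, $\|y\|_0^2=(y,y)$, $\|y]|_0^2=(y,y]$. "Absolutely stable" means stable with respect to the initial data and right-hand side (in the sense of the stated a priori estimate) for all grid steps $h,\tau$, with no restriction relating $\tau$ and $h$. Background: the scheme discretizes $\partial_{0t}^{\alpha(x)}u=(k u_x)_x-qu+f$ on $0<x<l$, $0<t\le T$, with $u(0,t)=u(l,t)=0$, $u(x,0)=u_0(x)$, where $\partial_{0t}^{\alpha(x)}u(x,t)=\frac{1}{\Gamma(1-\alpha(x))}\int_0^t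 u_\tau(x,\tau)(t-\tau)^{-\alpha(x)}\,d\tau$. The standing assumption is that this problem has a solution $u$ with continuous derivatives up to order 4 in $x$ and 3 in $t$, and that the coefficients, $f$ and $u_0$ are smooth enough for the scheme to have order of approximation $O(\tau+h^2)$. *)

theory Defs
  imports "HOL-Analysis.Analysis"
begin

text \<open>
  The space grid is $x_i = i h$ with $h = l/N$ and the time grid $t_j = j \tau$ with
  $\tau = T/j_0$.  A grid function is curried as \<open>y j i\<close>: first the time level \<open>j \<le> j0\<close>, then the
  space node \<open>i \<le> N\<close>; values outside that range are never used.
\<close>

definition space_step :: "real \<Rightarrow> nat \<Rightarrow> real" where
  "space_step l N = l / real N"

definition time_step :: "real \<Rightarrow> nat \<Rightarrow> real" where
  "time_step T j0 = T / real j0"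

definition node :: "real \<Rightarrow> nat \<Rightarrow> real" where
  "node step i = real i * step"

definition half_before :: "real \<Rightarrow> nat \<Rightarrow> real" where
  "half_before step i = (real i - 1/2) * step"

definition half_after :: "real \<Rightarrow> nat \<Rightarrow> real" where
  "half_after step j = (real j + 1/2) * step"

definition fwd_diff :: "real \<Rightarrow> (nat \<Rightarrow> real) \<Rightarrow> nat \<Rightarrow> real" where
  "fwd_diff step v i = (v (i + 1) - v i) / step"

text \<open>Only meant for \<open>i \<ge> 1\<close> (truncated subtraction).\<close>

definition bwd_diff :: "real \<Rightarrow> (nat \<Rightarrow> real) \<Rightarrow> nat \<Rightarrow> real" where
  "bwd_diff step v i = (v i - v (i - 1)) / step"

text \<open>
  \<open>w\<close> is a function of the time level.  In the last summand \<open>0 powr (1 - a) = 0\<close>, which is the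
  intended value of $t_0^{1-a}$ for $a < 1$.
\<close>

definition discrete_caputo :: "real \<Rightarrow> real \<Rightarrow> (nat \<Rightarrow> real) \<Rightarrow> nat \<Rightarrow> real" where
  "discrete_caputo \<tau> a w j =
     1 / Gamma (2 - a) *
     (\<Sum>s=0..j. (node \<tau> (j - s + 1) powr (1 - a) - node \<tau> (j - s) powr (1 - a)) * fwd_diff \<tau> w s)"

definition space_op ::
    "real \<Rightarrow> (nat \<Rightarrow> real) \<Rightarrow> (nat \<Rightarrow> real) \<Rightarrow> (nat \<Rightarrow> real) \<Rightarrow> nat \<Rightarrow> real" where
  "space_op h a d v i = fwd_diff h (\<lambda>m. a m * bwd_diff h v m) i - d i * v i"

definition weighted :: "real \<Rightarrow> (nat \<Rightarrow> nat \<Rightarrow> real) \<Rightarrow> nat \<Rightarrow> nat \<Rightarrow> real" where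
  "weighted \<sigma> y j i = \<sigma> * y (j + 1) i + (1 - \<sigma>) * y j i"

text \<open>The inner products $(u,v)$ and $(u,v]$ with the corresponding squared norms.\<close>

definition ip :: "nat \<Rightarrow> real \<Rightarrow> (nat \<Rightarrow> real) \<Rightarrow> (nat \<Rightarrow> real) \<Rightarrow> real" where
  "ip N h u v = (\<Sum>i=1..N-1. u i * v i * h)"

definition ip_right :: "nat \<Rightarrow> real \<Rightarrow> (nat \<Rightarrow> real) \<Rightarrow> (nat \<Rightarrow> real) \<Rightarrow> real" where
  "ip_right N h u v = (\<Sum>i=1..N. u i * v i * h)"

definition norm0_sq :: "nat \<Rightarrow> real \<Rightarrow> (nat \<Rightarrow> real) \<Rightarrow> real" where
  "norm0_sq N h v = ip N h v v"

definition norm0_right_sq :: "nat \<Rightarrow> real \<Rightarrow> (nat \<Rightarrow> real) \<Rightarrow> real" where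
  "norm0_right_sq N h v = ip_right N h v v"

text \<open>
  \<open>y\<close> solves the weighted scheme on the grid \<open>(N, j0)\<close> with right-hand side \<open>\<phi> j i\<close> and initial
  values \<open>g i\<close>, both given as grid functions so that the data can be varied for fixed
  coefficients.
\<close>

definition scheme_solution ::
    "real \<Rightarrow> real \<Rightarrow> nat \<Rightarrow> nat \<Rightarrow> (real \<Rightarrow> real) \<Rightarrow> (real \<Rightarrow> real \<Rightarrow> real) \<Rightarrow> (real \<Rightarrow> real \<Rightarrow> real) \<Rightarrow> real \<Rightarrow>
     (nat \<Rightarrow> nat \<Rightarrow> real) \<Rightarrow> (nat \<Rightarrow> real) \<Rightarrow> (nat \<Rightarrow> nat \<Rightarrow> real) \<Rightarrow> bool" where
  "scheme_solution l T N j0 \<alpha> k q \<sigma> \<phi> g y \<longleftrightarrow>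
     (let h = space_step l N; \<tau> = time_step T j0 in
       (\<forall>j<j0. \<forall>i\<in>{1..N-1}.
          discrete_caputo \<tau> (\<alpha> (node h i)) (\<lambda>s. y s i) j =
            space_op h (\<lambda>m. k (half_before h m) (half_after \<tau> j))
                       (\<lambda>m. q (node h m) (half_after \<tau> j))
                       (weighted \<sigma> y j) i
            + \<phi> j i) \<and>
       (\<forall>j\<le>j0. y j 0 = 0 \<and> y j N = 0) \<and>
       (\<forall>i\<le>N. y 0 i = g i))"

definition apriori_estimate ::
    "real \<Rightarrow> real \<Rightarrow> nat \<Rightarrow> nat \<Rightarrow> (real \<Rightarrow> real) \<Rightarrow> real \<Rightarrow> real \<Rightarrow>
     (nat \<Rightarrow> nat \<Rightarrow> real) \<Rightarrow> (nat \<Rightarrow> real) \<Rightarrow> (nat \<Rightarrow> nat \<Rightarrow> real) \<Rightarrow> nat \<Rightarrow> bool" where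
  "apriori_estimate l T N j0 \<alpha> c1 \<sigma> \<phi> g y j \<longleftrightarrow>
     (let h = space_step l N; \<tau> = time_step T j0; A = (\<lambda>i. \<alpha> (node h i)) in
        ip N h (\<lambda>i. 1 / Gamma (2 - A i))
               (\<lambda>i. \<Sum>s=0..j. (node \<tau> (j - s + 1) powr (1 - A i) - node \<tau> (j - s) powr (1 - A i))
                              * (y (s + 1) i)\<^sup>2)
        + c1 * (\<Sum>s=0..j. norm0_right_sq N h
                   (\<lambda>i. \<sigma> * bwd_diff h (y (s + 1)) i + (1 - \<sigma>) * bwd_diff h (y s) i) * \<tau>)
        \<le> l\<^sup>2 / (2 * c1) * (\<Sum>s=0..j. norm0_sq N h (\<phi> s) * \<tau>)
          + ip N h (\<lambda>i. node \<tau> (j + 1) powr (1 - A i) / Gamma (2 - A i)) (\<lambda>i. (g i)\<^sup>2))"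

text \<open>
  Stability with respect to the initial data and the right-hand side: the difference of two
  solutions is controlled, in the sense of the a priori estimate, by the difference of their data.
\<close>

definition stable_on_grid ::
    "real \<Rightarrow> real \<Rightarrow> nat \<Rightarrow> nat \<Rightarrow> (real \<Rightarrow> real) \<Rightarrow> (real \<Rightarrow> real \<Rightarrow> real) \<Rightarrow> (real \<Rightarrow> real \<Rightarrow> real) \<Rightarrow>
     real \<Rightarrow> real \<Rightarrow> bool" where
  "stable_on_grid l T N j0 \<alpha> k q c1 \<sigma> \<longleftrightarrow>
     (\<forall>\<phi> \<phi>' g g' y y'.
        scheme_solution l T N j0 \<alpha> k q \<sigma> \<phi> g y \<longrightarrow>
        scheme_solution l T N j0 \<alpha> k q \<sigma> \<phi>' g' y' \<longrightarrow>
        (\<forall>j<j0. apriori_estimate l T N j0 \<alpha> c1 \<sigma>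
           (\<lambda>s i. \<phi> s i - \<phi>' s i) (\<lambda>i. g i - g' i) (\<lambda>s i. y s i - y' s i) j))"

text \<open>
  Absolute stability over the space grids \<open>N \<in> Ns\<close>: every time grid is allowed with every such
  \<open>N\<close>, so \<open>\<tau>\<close> is not restricted in terms of \<open>h\<close>.  The set \<open>Ns\<close> is needed because the lower bound
  on the weight depends on the nodes of the space grid.
\<close>

definition absolutely_stable ::
    "nat set \<Rightarrow> real \<Rightarrow> real \<Rightarrow> (real \<Rightarrow> real) \<Rightarrow> (real \<Rightarrow> real \<Rightarrow> real) \<Rightarrow> (real \<Rightarrow> real \<Rightarrow> real) \<Rightarrow>
     real \<Rightarrow> real \<Rightarrow> bool" where
  "absolutely_stable Ns l T \<alpha> k q c1 \<sigma> \<longleftrightarrow>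
     (\<forall>N\<in>Ns. \<forall>j0\<ge>1. stable_on_grid l T N j0 \<alpha> k q c1 \<sigma>)"

definition min_order :: "real \<Rightarrow> nat \<Rightarrow> (real \<Rightarrow> real) \<Rightarrow> real" where
  "min_order l N \<alpha> = Min ((\<lambda>i. \<alpha> (node (space_step l N) i)) ` {1..N-1})"

end

theory Submission
  imports Defs
begin

text \<open>
  The scheme at level \<open>j\<close> is multiplied by $y^{(\sigma)} = \sigma y^{j+1} + (1-\sigma) y^j$ and summed
  over the space nodes.  Summation by parts makes the space operator contribute at most
  $-c_1 \|y^{(\sigma)}_{\bar x}]|_0^2$, and the Poincare inequality absorbs the right-hand side.
  For the memory term, the weights of the discrete Caputo derivative decrease with the age of the
  increment, and the lower bound on $\sigma$ is enough for
  $y^{(\sigma)} \Delta y \ge \frac12 \Delta (y^2)$.  Summing $\Delta (y^2)$ over the levels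
  telescopes into the left-hand side of the estimate.
\<close>

section \<open>Decay of the memory weights\<close>

text \<open>Concavity of \<open>z powr p\<close> on the half-line: by the mean value theorem each
  increment is \<tau> times a value of the derivative, which does not increase because
  \<open>p - 1 \<le> 0\<close>.\<close>

lemma powr_increments_antimono:
  fixes p x \<tau> :: real
  assumes "0 \<le> x" "0 < \<tau>" "0 < p" "p \<le> 1"
  shows "(x + 2 * \<tau>) powr p - (x + \<tau>) powr p \<le> (x + \<tau>) powr p - x powr p"
proof -
  have mvt: "\<exists>z. u < z \<and> z < u + \<tau> \<and> (u + \<tau>) powr p - u powr p = \<tau> * (p * z powr (p - 1))"
    if "0 \<le> u" for u
  proof -
    have deriv: "((\<lambda>z. z powr p) has_real_derivative p * z powr (p - 1)) (at z)" if "0 < z" for z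
      using has_real_derivative_powr[of z p] that by simp
    have "continuous_on {u..u + \<tau>} (\<lambda>z. z powr p)"
      using that assms by (intro continuous_on_powr') (auto intro!: continuous_intros)
    moreover have "(\<lambda>z. z powr p) differentiable (at z)" if "u < z" for z
      using deriv[of z] that \<open>0 \<le> u\<close> real_differentiable_def by force
    ultimately obtain d z where z: "u < z" "z < u + \<tau>"
        "((\<lambda>z. z powr p) has_real_derivative d) (at z)"
        "(u + \<tau>) powr p - u powr p = (u + \<tau> - u) * d"
      using MVT[of u "u + \<tau>" "\<lambda>z. z powr p"] assms by auto
    have "d = p * z powr (p - 1)"
      using DERIV_unique[OF z(3) deriv] z(1) that by simp
    then show ?thesis using z by auto
  qed
  obtain z1 where z1: "x < z1" "z1 < x + \<tau>"
      "(x + \<tau>) powr p - x powr p = \<tau> * (p * z1 powr (p - 1))"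
    using mvt[of x] assms by auto
  obtain z2 where z2: "x + \<tau> < z2"
      "(x + \<tau> + \<tau>) powr p - (x + \<tau>) powr p = \<tau> * (p * z2 powr (p - 1))"
    using mvt[of "x + \<tau>"] assms by auto
  have "z2 powr (p - 1) \<le> z1 powr (p - 1)"
    using assms z1 z2 by (intro powr_mono2') auto
  then have "\<tau> * (p * z2 powr (p - 1)) \<le> \<tau> * (p * z1 powr (p - 1))"
    using assms by (intro mult_left_mono) auto
  moreover have "x + \<tau> + \<tau> = x + 2 * \<tau>" by simp
  ultimately show ?thesis using z1(3) z2(2) by metis
qed

text \<open>Indexed by the age \<open>m = j - s\<close> of an increment, so that the memory sum
  becomes a discrete convolution whose kernel does not depend on \<open>j\<close>.\<close>

definition caputo_weight :: "real \<Rightarrow> real \<Rightarrow> nat \<Rightarrow> real" where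
  "caputo_weight \<tau> a m = node \<tau> (m + 1) powr (1 - a) - node \<tau> m powr (1 - a)"

lemma discrete_caputo_alt:
  "discrete_caputo \<tau> a w j =
     (\<Sum>s\<le>j. caputo_weight \<tau> a (j - s) * (w (s + 1) - w s)) / (Gamma (2 - a) * \<tau>)"
  by (simp add: discrete_caputo_def caputo_weight_def fwd_diff_def atLeast0AtMost
      sum_divide_distrib mult.commute)

lemma caputo_weight_nonneg:
  assumes "0 < \<tau>" "a < 1"
  shows "0 \<le> caputo_weight \<tau> a m"
  using assms by (auto simp: caputo_weight_def node_def intro!: powr_mono2 mult_right_mono)

lemma caputo_weight_Suc_le:
  assumes "0 < \<tau>" "0 < a" "a < 1"
  shows "caputo_weight \<tau> a (Suc m) \<le> caputo_weight \<tau> a m"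
  using powr_increments_antimono[of "node \<tau> m" \<tau> "1 - a"] assms
  by (simp add: caputo_weight_def node_def algebra_simps)

text \<open>As \<open>0 powr (1 - a) = 0\<close>, the newest weight is
  \<open>\<tau> powr (1 - a)\<close>, and the ratio of the two newest weights is free of \<tau>.
  This ratio brings \<open>2 powr (1 - a)\<close> into the bound on \<sigma>, which therefore does
  not restrict the time step.\<close>

lemma caputo_weight_1:
  assumes "0 < \<tau>" "a < 1"
  shows "caputo_weight \<tau> a 1 = (2 powr (1 - a) - 1) * caputo_weight \<tau> a 0"
  using assms by (simp add: caputo_weight_def node_def powr_mult algebra_simps)

section \<open>The discrete fractional derivative of a square\<close>

text \<open>Abel summation: after rearrangement \<open>G 0\<close> has the coefficient
  \<open>c 0\<close> and each \<open>G (Suc s)\<close> with \<open>s < n\<close> the coefficient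
  \<open>c (Suc s) - c s\<close>. All of these are nonnegative and sum to \<open>c n\<close>, so
  every such \<open>G\<close> may be replaced by \<open>- M\<close>.\<close>

lemma weighted_telescope_lower_bound:
  fixes c G :: "nat \<Rightarrow> real"
  assumes "\<And>s. s \<le> n \<Longrightarrow> - M \<le> G s" "0 \<le> c 0" "\<And>s. s < n \<Longrightarrow> c s \<le> c (Suc s)"
  shows "- c n * (M + G (Suc n)) \<le> (\<Sum>s\<le>n. c s * (G s - G (Suc s)))"
  using assms
proof (induction n)
  case 0
  then have "c 0 * (- M) \<le> c 0 * G 0"
    by (intro mult_left_mono) auto
  then show ?case by (simp add: algebra_simps)
next
  case (Suc n)
  have "- c n * (M + G (Suc n)) \<le> (\<Sum>s\<le>n. c s * (G s - G (Suc s)))"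
    using Suc by simp
  moreover have "0 \<le> (c (Suc n) - c n) * (M + G (Suc n))"
    using Suc.prems(1)[of "Suc n"] Suc.prems(3)[of n] by (intro mult_nonneg_nonneg) auto
  ultimately show ?case by (simp add: algebra_simps)
qed

text \<open>For \<open>b = 2 powr (1 - a) - 1\<close> the threshold \<open>1 / (2 - b)\<close> is
  the bound on \<sigma> in the scheme. It says both
  \<open>1 - \<sigma> \<le> (1 - b) * \<sigma>\<close> and
  \<open>b * \<sigma> \<le> 2 * \<sigma> - 1\<close>. The first is applied to one factor of the
  square, the other factor is bounded by 1, and the second finishes.\<close>

lemma half_le_weight:
  fixes b \<sigma> :: real
  assumes "0 \<le> b" "b < 1" "1 / (2 - b) \<le> \<sigma>" "\<sigma> \<le> 1"
  shows "1 / 2 \<le> \<sigma>" and "b * (1 - \<sigma>)\<^sup>2 \<le> (1 - b) * (2 * \<sigma> - 1)"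
proof -
  have s: "1 \<le> (2 - b) * \<sigma>"
    using assms by (simp add: divide_simps mult.commute)
  have pos: "0 < \<sigma>"
    using assms by (smt (verit) divide_pos_pos)
  then have "0 \<le> b * \<sigma>"
    using assms by simp
  then show "1 / 2 \<le> \<sigma>"
    using s by (simp add: algebra_simps)
  have "b * (1 - \<sigma>)\<^sup>2 = (b * (1 - \<sigma>)) * (1 - \<sigma>)"
    by (simp add: power2_eq_square)
  also have "\<dots> \<le> (b * (1 - \<sigma>)) * ((1 - b) * \<sigma>)"
  proof (rule mult_left_mono)
    show "1 - \<sigma> \<le> (1 - b) * \<sigma>"
      using s by (simp add: algebra_simps)
  qed (use assms in auto)
  also have "\<dots> = (1 - b) * (b * \<sigma> * (1 - \<sigma>))"
    by simp
  also have "\<dots> \<le> (1 - b) * (b * \<sigma> * 1)"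
    using \<open>0 \<le> b * \<sigma>\<close> pos assms by (intro mult_left_mono) auto
  also have "\<dots> \<le> (1 - b) * (2 * \<sigma> - 1)"
    using s assms by (intro mult_left_mono) (auto simp: algebra_simps)
  finally show "b * (1 - \<sigma>)\<^sup>2 \<le> (1 - b) * (2 * \<sigma> - 1)" .
qed

text \<open>Discrete analogue of the inequality between the Caputo derivative of \<open>w^2\<close>
  and \<open>2 * w\<close> times that of \<open>w\<close>. Up to a positive factor the right side
  minus the left is a sum of terms \<open>c s * (G s - G (Suc s))\<close>; the newest term outweighs
  what Abel summation loses on the older ones.\<close>

lemma discrete_caputo_square_le:
  assumes "0 < \<tau>" "0 < a" "a < 1" "1 / (3 - 2 powr (1 - a)) \<le> \<sigma>" "\<sigma> \<le> 1"
  shows "discrete_caputo \<tau> a (\<lambda>s. (w s)\<^sup>2) j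
    \<le> 2 * (\<sigma> * w (j + 1) + (1 - \<sigma>) * w j) * discrete_caputo \<tau> a w j"
proof -
  define b where "b = 2 powr (1 - a) - 1"
  have "2 powr 0 \<le> (2::real) powr (1 - a)" "2 powr (1 - a) < (2::real) powr 1"
    using assms by (intro powr_mono powr_less_mono; simp)+
  then have b: "0 \<le> b" "b < 1"
    by (auto simp: b_def)
  have sigma: "1 / 2 \<le> \<sigma>" "b * (1 - \<sigma>)\<^sup>2 \<le> (1 - b) * (2 * \<sigma> - 1)"
    using half_le_weight[OF b, of \<sigma>] assms by (auto simp: b_def)
  define c where "c s = caputo_weight \<tau> a (j - s)" for s
  define d where "d = w (j + 1) - w j"
  define M where "M = (1 - \<sigma>)\<^sup>2 * d\<^sup>2 / 2"
  define v where "v = \<sigma> * w (j + 1) + (1 - \<sigma>) * w j"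
  \<comment> \<open>The coefficient of \<open>c s\<close> below is \<open>G s - G (s + 1)\<close>; completing the square in
    \<open>w (j + 1) - w s\<close> gives the lower bound \<open>- M\<close> for \<open>G\<close>.\<close>
  define G where "G s = (w (j + 1) - w s)\<^sup>2 / 2 - (1 - \<sigma>) * d * (w (j + 1) - w s)" for s
  have G_ge: "- M \<le> G s" for s
  proof -
    have "0 \<le> ((w (j + 1) - w s) - (1 - \<sigma>) * d)\<^sup>2 / 2"
      by simp
    also have "\<dots> = G s + M"
      by (simp add: G_def M_def power2_eq_square field_simps)
    finally show ?thesis by simp
  qed
  have G_last: "G (Suc j) = 0" "G j = (\<sigma> - 1 / 2) * d\<^sup>2"
    by (simp_all add: G_def d_def power2_eq_square field_simps)
  have term_eq: "2 * v * (w (s + 1) - w s) - ((w (s + 1))\<^sup>2 - (w s)\<^sup>2) = 2 * (G s - G (Suc s))" for s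
    by (simp add: v_def G_def d_def power2_eq_square field_simps)
  \<comment> \<open>At level 0 there are no older increments and \<open>\<sigma> \<ge> 1 / 2\<close>
    suffices. At later levels the newest term must also pay for the memory.\<close>
  have "0 \<le> (\<Sum>s\<le>j. c s * (G s - G (Suc s)))"
  proof (cases j)
    case 0
    have "0 \<le> c 0 * G j"
      using sigma caputo_weight_nonneg[of \<tau> a 0] assms G_last(2) by (simp add: c_def 0)
    then show ?thesis using G_last by (simp add: 0)
  next
    case (Suc n)
    have mono: "c s \<le> c (Suc s)" if "s < j" for s
    proof -
      have "j - s = Suc (j - Suc s)" using that by simp
      then show ?thesis using assms by (simp add: c_def caputo_weight_Suc_le)
    qed
    \<comment> \<open>Since \<open>n = j - 1\<close>, these are the weights of ages 1 and 0.\<close>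
    have cn: "c n = b * c j"
      using caputo_weight_1[of \<tau> a] assms by (simp add: c_def b_def Suc)
    have cj: "0 \<le> c j"
      using caputo_weight_nonneg assms by (simp add: c_def)
    \<comment> \<open>The term \<open>s = j\<close> is kept apart: telescoping through it would
      leave only \<open>- c j * M\<close>. The older terms cost at most
      \<open>c n * (M + G j)\<close>, and \<open>c n = b * c j\<close> reduces the balance with
      \<open>c j * G j\<close> to the quadratic condition on \<sigma>.\<close>
    have "- c n * (M + G (Suc n)) \<le> (\<Sum>s\<le>n. c s * (G s - G (Suc s)))"
      using caputo_weight_nonneg assms mono G_ge Suc
      by (intro weighted_telescope_lower_bound) (auto simp: c_def)
    then have "c j * G j - c n * (M + G j) \<le> (\<Sum>s\<le>j. c s * (G s - G (Suc s)))"
      using G_last(1) by (simp add: Suc)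
    moreover have "c j * G j - c n * (M + G j) =
        c j * d\<^sup>2 / 2 * ((1 - b) * (2 * \<sigma> - 1) - b * (1 - \<sigma>)\<^sup>2)"
      by (simp add: cn G_last M_def field_simps)
    moreover have "0 \<le> c j * d\<^sup>2 / 2 * ((1 - b) * (2 * \<sigma> - 1) - b * (1 - \<sigma>)\<^sup>2)"
      using sigma cj by (intro mult_nonneg_nonneg) auto
    ultimately show ?thesis by linarith
  qed
  also have "\<dots> = ((\<Sum>s\<le>j. c s * (2 * v * (w (s + 1) - w s) - ((w (s + 1))\<^sup>2 - (w s)\<^sup>2)))) / 2"
    unfolding term_eq mult.left_commute[of _ 2] sum_distrib_left[symmetric] by simp
  finally have "(\<Sum>s\<le>j. c s * ((w (s + 1))\<^sup>2 - (w s)\<^sup>2)) \<le> 2 * v * (\<Sum>s\<le>j. c s * (w (s + 1) - w s))"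
    by (simp add: right_diff_distrib sum_subtractf sum_distrib_left mult.left_commute)
  moreover have "0 < Gamma (2 - a) * \<tau>"
    using assms by simp
  ultimately have "(\<Sum>s\<le>j. c s * ((w (s + 1))\<^sup>2 - (w s)\<^sup>2)) / (Gamma (2 - a) * \<tau>)
      \<le> 2 * v * (\<Sum>s\<le>j. c s * (w (s + 1) - w s)) / (Gamma (2 - a) * \<tau>)"
    by (intro divide_right_mono) auto
  then show ?thesis
    by (simp add: discrete_caputo_alt c_def v_def)
qed

section \<open>Summation over the time levels\<close>

text \<open>Telescoping of the convolution: at each new level the sum over the old values, shifted
  by one index, cancels the sum accumulated so far. Only \<open>z 0\<close> survives, and its
  weights add up to \<open>node \<tau> (j + 1) powr (1 - a)\<close>.\<close>

lemma sum_discrete_caputo: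
  assumes "0 < \<tau>" "a < 1"
  shows "\<tau> * (\<Sum>n\<le>j. discrete_caputo \<tau> a z n) =
    ((\<Sum>s\<le>j. caputo_weight \<tau> a (j - s) * z (s + 1)) - node \<tau> (j + 1) powr (1 - a) * z 0)
      / Gamma (2 - a)"
proof -
  let ?b = "caputo_weight \<tau> a"
  have "(\<Sum>n\<le>j. \<Sum>s\<le>n. ?b (n - s) * (z (s + 1) - z s)) =
    (\<Sum>s\<le>j. ?b (j - s) * z (s + 1)) - node \<tau> (j + 1) powr (1 - a) * z 0"
  proof (induction j)
    case 0
    then show ?case
      by (simp add: caputo_weight_def node_def algebra_simps)
  next
    case (Suc j)
    have "(\<Sum>s\<le>Suc j. ?b (Suc j - s) * z s) = ?b (Suc j) * z 0 + (\<Sum>s\<le>j. ?b (j - s) * z (s + 1))"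
      by (subst sum.atMost_Suc_shift) simp
    moreover have "node \<tau> (Suc j + 1) powr (1 - a) = ?b (Suc j) + node \<tau> (j + 1) powr (1 - a)"
      by (simp add: caputo_weight_def)
    then have "node \<tau> (Suc j + 1) powr (1 - a) * z 0 =
        ?b (Suc j) * z 0 + node \<tau> (j + 1) powr (1 - a) * z 0"
      by (simp only: distrib_right)
    moreover have "(\<Sum>s\<le>Suc j. ?b (Suc j - s) * (z (s + 1) - z s)) =
        (\<Sum>s\<le>Suc j. ?b (Suc j - s) * z (s + 1)) - (\<Sum>s\<le>Suc j. ?b (Suc j - s) * z s)"
      by (simp only: right_diff_distrib sum_subtractf)
    ultimately show ?case
      using Suc by (simp only: sum.atMost_Suc[of _ j, where g = "\<lambda>n. \<Sum>s\<le>n. ?b (n - s) * (z (s + 1) - z s)"])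
  qed
  then have "(\<Sum>n\<le>j. discrete_caputo \<tau> a z n) =
    ((\<Sum>s\<le>j. ?b (j - s) * z (s + 1)) - node \<tau> (j + 1) powr (1 - a) * z 0) / (Gamma (2 - a) * \<tau>)"
    by (simp add: discrete_caputo_alt flip: sum_divide_distrib)
  then show ?thesis using assms by simp
qed

section \<open>Energy estimate for the space operator\<close>

lemma ip_fwd_diff:
  assumes "h \<noteq> 0" "v 0 = 0" "v N = 0" "1 \<le> N"
  shows "ip N h v (fwd_diff h g) = - ip_right N h g (bwd_diff h v)"
proof -
  have parts: "(\<Sum>i=1..n. v i * (g (i + 1) - g i)) + (\<Sum>i=1..n. g i * (v i - v (i - 1))) =
      v n * g (n + 1) - v 0 * g 1" for n
    by (induction n) (auto simp: algebra_simps)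
  obtain n where N: "N = Suc n"
    using assms(4) by (cases N) auto
  \<comment> \<open>Because \<open>v N = 0\<close>, the sum extends from \<open>N - 1\<close> to
    \<open>N\<close> at no cost, and the value \<open>g (N + 1)\<close> beyond the grid enters with
    factor 0.\<close>
  have "ip N h v (fwd_diff h g) = (\<Sum>i=1..N. v i * (g (i + 1) - g i))"
    using assms by (simp add: ip_def fwd_diff_def N)
  moreover have "ip_right N h g (bwd_diff h v) = (\<Sum>i=1..N. g i * (v i - v (i - 1)))"
    using assms by (simp add: ip_right_def bwd_diff_def)
  ultimately show ?thesis
    using parts[of N] assms by simp
qed

text \<open>Each \<open>v i\<close> is the sum of its differences from the left end, so
  Cauchy-Schwarz bounds its square by \<open>i * h\<close> times the squared norm of the difference
  quotient; the factors \<open>i\<close> are then summed.\<close>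

lemma discrete_poincare:
  assumes "0 < l" "1 \<le> N" "v 0 = 0"
  defines "h \<equiv> space_step l N"
  shows "norm0_sq N h v \<le> l\<^sup>2 / 2 * norm0_right_sq N h (bwd_diff h v)"
proof -
  let ?S = "norm0_right_sq N h (bwd_diff h v)"
  have h: "0 < h" "real N * h = l"
    using assms by (simp_all add: space_step_def)
  have S: "h * ?S = (\<Sum>m=1..N. (v m - v (m - 1))\<^sup>2)"
    using h(1) by (simp add: norm0_right_sq_def ip_right_def bwd_diff_def sum_distrib_left
        power2_eq_square)
  have S_nonneg: "0 \<le> h * ?S"
    unfolding S by (intro sum_nonneg) auto
  have pointwise: "(v i)\<^sup>2 \<le> real i * (h * ?S)" if "i \<le> N" for i
  proof -
    have "(\<Sum>m=1..n. v m - v (m - 1)) = v n - v 0" for n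
      by (induction n) auto
    then have "(v i)\<^sup>2 = (\<Sum>m=1..i. v m - v (m - 1))\<^sup>2"
      using assms(3) by simp
    also have "\<dots> \<le> (\<Sum>m=1..i. (v m - v (m - 1))\<^sup>2) * real (card {1..i})"
      by (rule sum_squared_le_sum_of_squares)
    also have "\<dots> \<le> (\<Sum>m=1..N. (v m - v (m - 1))\<^sup>2) * real (card {1..i})"
      using that by (intro mult_right_mono sum_mono2) auto
    finally show ?thesis by (simp add: S mult.commute)
  qed
  have "norm0_sq N h v = (\<Sum>i=1..N-1. (v i)\<^sup>2 * h)"
    by (simp add: norm0_sq_def ip_def power2_eq_square)
  also have "\<dots> \<le> (\<Sum>i=1..N-1. real i * (h * ?S) * h)"
    using h pointwise by (intro sum_mono mult_right_mono) auto
  also have "\<dots> = (\<Sum>i=1..N-1. real i) * (h * ?S) * h"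
    by (simp add: sum_distrib_right)
  also have "(\<Sum>i=1..N-1. real i) = real (N - 1) * real N / 2"
    using double_gauss_sum_from_Suc_0[of "N - 1", where ?'a = real] assms(2) by simp
  \<comment> \<open>Rounding \<open>N - 1\<close> up to \<open>N\<close> makes
    \<open>N * h = l\<close> appear, so the constant does not depend on \<open>h\<close>.\<close>
  also have "real (N - 1) * real N / 2 * (h * ?S) * h \<le> real N * real N / 2 * (h * ?S) * h"
    using S_nonneg h by (intro mult_right_mono divide_right_mono) auto
  also have "\<dots> = (real N * h)\<^sup>2 / 2 * ?S"
    by (simp add: power2_eq_square)
  finally show ?thesis by (simp add: h)
qed

text \<open>Summation by parts makes the doubled operator term at most \<open>- 2 * c1\<close> times
  the squared norm of the difference quotient. One half absorbs the right-hand side, the other half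
  remains in the estimate.\<close>

lemma space_energy:
  assumes "0 < l" "1 \<le> N" "v 0 = 0" "v N = 0" "0 < c1"
    and a: "\<And>i. i \<in> {1..N} \<Longrightarrow> c1 \<le> a i"
    and d: "\<And>i. i \<in> {1..N-1} \<Longrightarrow> 0 \<le> d i"
  defines "h \<equiv> space_step l N"
  shows "2 * ip N h v (\<lambda>i. space_op h a d v i + r i) + c1 * norm0_right_sq N h (bwd_diff h v)
    \<le> l\<^sup>2 / (2 * c1) * norm0_sq N h r"
proof -
  let ?S = "norm0_right_sq N h (bwd_diff h v)"
  have h: "0 < h"
    using assms by (simp add: space_step_def)
  have "ip N h v (space_op h a d v) =
      ip N h v (fwd_diff h (\<lambda>m. a m * bwd_diff h v m)) - (\<Sum>i=1..N-1. d i * (v i)\<^sup>2 * h)"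
    by (simp add: ip_def space_op_def algebra_simps power2_eq_square sum_subtractf)
  also have "ip N h v (fwd_diff h (\<lambda>m. a m * bwd_diff h v m)) =
      - ip_right N h (\<lambda>m. a m * bwd_diff h v m) (bwd_diff h v)"
    using h assms by (intro ip_fwd_diff) auto
  finally have op: "ip N h v (space_op h a d v) =
      - ip_right N h (\<lambda>m. a m * bwd_diff h v m) (bwd_diff h v) - (\<Sum>i=1..N-1. d i * (v i)\<^sup>2 * h)" .
  have "0 \<le> (\<Sum>i=1..N-1. d i * (v i)\<^sup>2 * h)"
    using d h by (intro sum_nonneg mult_nonneg_nonneg) auto
  moreover have "c1 * ?S \<le> ip_right N h (\<lambda>m. a m * bwd_diff h v m) (bwd_diff h v)"
  proof -
    have "c1 * ?S = (\<Sum>i=1..N. c1 * ((bwd_diff h v i)\<^sup>2 * h))"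
      by (simp add: norm0_right_sq_def ip_right_def sum_distrib_left power2_eq_square)
    also have "\<dots> \<le> (\<Sum>i=1..N. a i * ((bwd_diff h v i)\<^sup>2 * h))"
      using a h by (intro sum_mono mult_right_mono) auto
    finally show ?thesis
      by (simp add: ip_right_def power2_eq_square mult.assoc)
  qed
  ultimately have op_le: "ip N h v (space_op h a d v) \<le> - c1 * ?S"
    using op by simp
  \<comment> \<open>The weight \<open>2 * c1 / l\<^sup>2\<close> is chosen so that the Poincare
    constant \<open>l\<^sup>2 / 2\<close> turns the first term into exactly
    \<open>c1 * ?S\<close>.\<close>
  have young: "2 * (x * y) \<le> 2 * c1 / l\<^sup>2 * x\<^sup>2 + l\<^sup>2 / (2 * c1) * y\<^sup>2" for x y :: real
  proof -
    have "0 \<le> (2 * c1 * x - l\<^sup>2 * y)\<^sup>2 / (2 * c1 * l\<^sup>2)"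
      using assms by simp
    also have "\<dots> = 2 * c1 / l\<^sup>2 * x\<^sup>2 + l\<^sup>2 / (2 * c1) * y\<^sup>2 - 2 * (x * y)"
      using assms by (simp add: field_simps power2_eq_square)
    finally show ?thesis by simp
  qed
  have "2 * ip N h v r = (\<Sum>i=1..N-1. 2 * (v i * r i) * h)"
    by (simp add: ip_def sum_distrib_left mult.assoc)
  also have "\<dots> \<le> (\<Sum>i=1..N-1. (2 * c1 / l\<^sup>2 * (v i)\<^sup>2 + l\<^sup>2 / (2 * c1) * (r i)\<^sup>2) * h)"
    using h by (intro sum_mono mult_right_mono young) auto
  also have "\<dots> = 2 * c1 / l\<^sup>2 * norm0_sq N h v + l\<^sup>2 / (2 * c1) * norm0_sq N h r"
    by (simp add: norm0_sq_def ip_def distrib_right sum.distrib sum_distrib_left power2_eq_square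
        mult.assoc)
  also have "2 * c1 / l\<^sup>2 * norm0_sq N h v \<le> 2 * c1 / l\<^sup>2 * (l\<^sup>2 / 2 * ?S)"
    using discrete_poincare[of l N v] assms by (intro mult_left_mono) (auto simp: h_def)
  also have "\<dots> = c1 * ?S"
    using assms by simp
  finally have "2 * ip N h v r \<le> c1 * ?S + l\<^sup>2 / (2 * c1) * norm0_sq N h r"
    by simp
  moreover have "ip N h v (\<lambda>i. space_op h a d v i + r i) = ip N h v (space_op h a d v) + ip N h v r"
    by (simp add: ip_def algebra_simps sum.distrib)
  ultimately show ?thesis
    using op_le by simp
qed

section \<open>The a priori estimate\<close>

lemma bwd_diff_weighted:
  "bwd_diff h (weighted \<sigma> y s) i = \<sigma> * bwd_diff h (y (s + 1)) i + (1 - \<sigma>) * bwd_diff h (y s) i"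
  by (cases "h = 0") (simp_all add: bwd_diff_def weighted_def field_simps)

text \<open>The data are arbitrary grid functions, so that the result also covers the difference of
  two solutions. One energy inequality per time level is multiplied by \<tau> and summed.\<close>

lemma scheme_solution_apriori:
  assumes "0 < l" "0 < T" "0 < c1" "\<sigma> \<le> 1"
    and N: "2 \<le> N" and "j < j0"
    and alpha: "\<And>x. x \<in> {0<..<l} \<Longrightarrow> 0 < \<alpha> x \<and> \<alpha> x < 1"
    and k: "\<And>x t. x \<in> {0..l} \<Longrightarrow> t \<in> {0..T} \<Longrightarrow> c1 \<le> k x t"
    and q: "\<And>x t. x \<in> {0..l} \<Longrightarrow> t \<in> {0..T} \<Longrightarrow> 0 \<le> q x t"
    and sigma: "1 / (3 - 2 powr (1 - min_order l N \<alpha>)) \<le> \<sigma>"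
    and sol: "scheme_solution l T N j0 \<alpha> k q \<sigma> \<phi> g y"
  shows "apriori_estimate l T N j0 \<alpha> c1 \<sigma> \<phi> g y j"
proof -
  define h where "h = space_step l N"
  define \<tau> where "\<tau> = time_step T j0"
  define A where "A i = \<alpha> (node h i)" for i
  define S where "S n = norm0_right_sq N h (bwd_diff h (weighted \<sigma> y n))" for n
  have h: "0 < h" "real N * h = l"
    using assms by (simp_all add: h_def space_step_def)
  have tau: "0 < \<tau>" "real j0 * \<tau> = T"
    using assms by (simp_all add: \<tau>_def time_step_def)
  have scheme: "discrete_caputo \<tau> (A i) (\<lambda>s. y s i) n =
      space_op h (\<lambda>m. k (half_before h m) (half_after \<tau> n)) (\<lambda>m. q (node h m) (half_after \<tau> n))
        (weighted \<sigma> y n) i + \<phi> n i" if "n < j0" "i \<in> {1..N-1}" for n i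
    using sol that by (auto simp: scheme_solution_def Let_def h_def \<tau>_def A_def)
  have boundary: "y n 0 = 0" "y n N = 0" if "n \<le> j0" for n
    using sol that by (auto simp: scheme_solution_def Let_def)
  have initial: "y 0 i = g i" if "i \<le> N" for i
    using sol that by (auto simp: scheme_solution_def Let_def)
  have interior: "node h i \<in> {0<..<l}" if "i \<in> {1..N-1}" for i
  proof -
    have "real i * h < real N * h"
      using that h N by (intro mult_strict_right_mono) auto
    then show ?thesis using that h by (simp add: node_def)
  qed
  have A: "0 < A i" "A i < 1" if "i \<in> {1..N-1}" for i
    using alpha interior[OF that] by (auto simp: A_def)
  \<comment> \<open>The threshold decreases in the order, so the smallest order is the worst case.
    Its positivity keeps the denominators above 1.\<close>
  have A_sigma: "1 / (3 - 2 powr (1 - A i)) \<le> \<sigma>" if "i \<in> {1..N-1}" for i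
  proof -
    have "min_order l N \<alpha> = Min (A ` {1..N-1})"
      by (simp add: min_order_def A_def h_def)
    then have "min_order l N \<alpha> \<le> A i" "min_order l N \<alpha> \<in> A ` {1..N-1}"
      using that N by (auto intro!: Min_in)
    then have "min_order l N \<alpha> \<le> A i" "0 < min_order l N \<alpha>"
      using A by auto
    then have "2 powr (1 - A i) \<le> 2 powr (1 - min_order l N \<alpha>)"
        "2 powr (1 - min_order l N \<alpha>) < (2::real) powr 1"
      by (intro powr_mono powr_less_mono; simp)+
    then have "1 / (3 - 2 powr (1 - A i)) \<le> 1 / (3 - 2 powr (1 - min_order l N \<alpha>))"
      by (intro frac_le) auto
    with sigma show ?thesis by simp
  qed
  have level: "(\<Sum>i=1..N-1. discrete_caputo \<tau> (A i) (\<lambda>s. (y s i)\<^sup>2) n * h) + c1 * S n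
      \<le> l\<^sup>2 / (2 * c1) * norm0_sq N h (\<phi> n)" if n: "n < j0" for n
  proof -
    have "(real n + 1 / 2) * \<tau> \<le> real j0 * \<tau>"
      using n tau by (intro mult_right_mono) auto
    then have t: "half_after \<tau> n \<in> {0..T}"
      using tau by (simp add: half_after_def)
    have half: "half_before h m \<in> {0..l}" if "m \<in> {1..N}" for m
    proof -
      have "(real m - 1 / 2) * h \<le> real N * h"
        using that h by (intro mult_right_mono) auto
      then show ?thesis using that h by (simp add: half_before_def)
    qed
    have "(\<Sum>i=1..N-1. discrete_caputo \<tau> (A i) (\<lambda>s. (y s i)\<^sup>2) n * h) \<le>
        (\<Sum>i=1..N-1. 2 * weighted \<sigma> y n i * discrete_caputo \<tau> (A i) (\<lambda>s. y s i) n * h)"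
      unfolding weighted_def
      using assms tau h A A_sigma by (intro sum_mono mult_right_mono discrete_caputo_square_le) auto
    also have "\<dots> = 2 * ip N h (weighted \<sigma> y n)
        (\<lambda>i. space_op h (\<lambda>m. k (half_before h m) (half_after \<tau> n))
          (\<lambda>m. q (node h m) (half_after \<tau> n)) (weighted \<sigma> y n) i + \<phi> n i)"
      unfolding ip_def sum_distrib_left
      by (intro sum.cong refl) (simp add: scheme[OF n])
    finally have "(\<Sum>i=1..N-1. discrete_caputo \<tau> (A i) (\<lambda>s. (y s i)\<^sup>2) n * h) \<le> \<dots>" .
    moreover have "2 * ip N h (weighted \<sigma> y n)
        (\<lambda>i. space_op h (\<lambda>m. k (half_before h m) (half_after \<tau> n))
          (\<lambda>m. q (node h m) (half_after \<tau> n)) (weighted \<sigma> y n) i + \<phi> n i) + c1 * S n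
        \<le> l\<^sup>2 / (2 * c1) * norm0_sq N h (\<phi> n)"
      unfolding S_def h_def
    proof (rule space_energy)
      show "weighted \<sigma> y n 0 = 0" "weighted \<sigma> y n N = 0"
        using boundary n by (simp_all add: weighted_def)
      show "0 \<le> q (node (space_step l N) i) (half_after \<tau> n)" if "i \<in> {1..N-1}" for i
        using q interior[OF that] t by (simp add: h_def)
      show "c1 \<le> k (half_before (space_step l N) i) (half_after \<tau> n)" if "i \<in> {1..N}" for i
        using k half[OF that] t by (simp add: h_def)
    qed (use assms in auto)
    ultimately show ?thesis by linarith
  qed
  have total: "(\<Sum>n\<le>j. \<tau> * (\<Sum>i=1..N-1. discrete_caputo \<tau> (A i) (\<lambda>s. (y s i)\<^sup>2) n * h) + c1 * (S n * \<tau>))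
      \<le> (\<Sum>n\<le>j. l\<^sup>2 / (2 * c1) * (norm0_sq N h (\<phi> n) * \<tau>))"
  proof (intro sum_mono)
    fix n assume "n \<in> {..j}"
    then show "\<tau> * (\<Sum>i=1..N-1. discrete_caputo \<tau> (A i) (\<lambda>s. (y s i)\<^sup>2) n * h) + c1 * (S n * \<tau>)
        \<le> l\<^sup>2 / (2 * c1) * (norm0_sq N h (\<phi> n) * \<tau>)"
      using mult_right_mono[OF level, of n \<tau>] tau \<open>j < j0\<close> by (simp add: algebra_simps)
  qed
  \<comment> \<open>The order varies with the node, so the sums are exchanged and the telescoping in
    time is done at each node separately.\<close>
  have "(\<Sum>n\<le>j. \<tau> * (\<Sum>i=1..N-1. discrete_caputo \<tau> (A i) (\<lambda>s. (y s i)\<^sup>2) n * h)) =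
      (\<Sum>i=1..N-1. \<tau> * (\<Sum>n\<le>j. discrete_caputo \<tau> (A i) (\<lambda>s. (y s i)\<^sup>2) n) * h)"
    unfolding sum_distrib_left sum_distrib_right
    by (subst sum.swap) (simp add: mult.assoc)
  also have "\<dots> = (\<Sum>i=1..N-1. ((\<Sum>s\<le>j. caputo_weight \<tau> (A i) (j - s) * (y (s + 1) i)\<^sup>2)
      - node \<tau> (j + 1) powr (1 - A i) * (g i)\<^sup>2) / Gamma (2 - A i) * h)"
  proof (intro sum.cong refl)
    fix i assume i: "i \<in> {1..N-1}"
    then have "i \<le> N" by auto
    with i show "\<tau> * (\<Sum>n\<le>j. discrete_caputo \<tau> (A i) (\<lambda>s. (y s i)\<^sup>2) n) * h =
        ((\<Sum>s\<le>j. caputo_weight \<tau> (A i) (j - s) * (y (s + 1) i)\<^sup>2)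
          - node \<tau> (j + 1) powr (1 - A i) * (g i)\<^sup>2) / Gamma (2 - A i) * h"
      using tau A[of i] initial[of i] by (simp add: sum_discrete_caputo)
  qed
  also have "\<dots> = ip N h (\<lambda>i. 1 / Gamma (2 - A i))
        (\<lambda>i. \<Sum>s\<le>j. caputo_weight \<tau> (A i) (j - s) * (y (s + 1) i)\<^sup>2)
      - ip N h (\<lambda>i. node \<tau> (j + 1) powr (1 - A i) / Gamma (2 - A i)) (\<lambda>i. (g i)\<^sup>2)"
    by (simp add: ip_def diff_divide_distrib left_diff_distrib sum_subtractf)
  finally have memory: "(\<Sum>n\<le>j. \<tau> * (\<Sum>i=1..N-1. discrete_caputo \<tau> (A i) (\<lambda>s. (y s i)\<^sup>2) n * h)) =
      ip N h (\<lambda>i. 1 / Gamma (2 - A i))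
        (\<lambda>i. \<Sum>s\<le>j. caputo_weight \<tau> (A i) (j - s) * (y (s + 1) i)\<^sup>2)
      - ip N h (\<lambda>i. node \<tau> (j + 1) powr (1 - A i) / Gamma (2 - A i)) (\<lambda>i. (g i)\<^sup>2)" .
  have "ip N h (\<lambda>i. 1 / Gamma (2 - A i))
        (\<lambda>i. \<Sum>s\<le>j. caputo_weight \<tau> (A i) (j - s) * (y (s + 1) i)\<^sup>2)
      + c1 * (\<Sum>n\<le>j. S n * \<tau>)
      \<le> l\<^sup>2 / (2 * c1) * (\<Sum>n\<le>j. norm0_sq N h (\<phi> n) * \<tau>)
      + ip N h (\<lambda>i. node \<tau> (j + 1) powr (1 - A i) / Gamma (2 - A i)) (\<lambda>i. (g i)\<^sup>2)"
    using total
    unfolding sum.distrib memory sum_distrib_left[of c1, symmetric]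
      sum_distrib_left[of "l\<^sup>2 / (2 * c1)", symmetric]
    by linarith
  moreover have "S n = norm0_right_sq N h
      (\<lambda>i. \<sigma> * bwd_diff h (y (n + 1)) i + (1 - \<sigma>) * bwd_diff h (y n) i)" for n
    by (simp add: S_def bwd_diff_weighted[abs_def])
  ultimately show ?thesis
    unfolding apriori_estimate_def Let_def h_def[symmetric] \<tau>_def[symmetric] A_def[symmetric]
      atLeast0AtMost caputo_weight_def by simp
qed

section \<open>Linearity and stability\<close>

lemma space_op_diff:
  "space_op h a d (\<lambda>i. u i - v i) i = space_op h a d u i - space_op h a d v i"
  by (simp add: space_op_def fwd_diff_def bwd_diff_def diff_divide_distrib right_diff_distrib)

lemma space_op_weighted_diff:
  "space_op h a d (weighted \<sigma> (\<lambda>s i. y s i - y' s i) j) i =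
    space_op h a d (weighted \<sigma> y j) i - space_op h a d (weighted \<sigma> y' j) i"
proof -
  have "weighted \<sigma> (\<lambda>s i. y s i - y' s i) j = (\<lambda>i. weighted \<sigma> y j i - weighted \<sigma> y' j i)"
    by (simp add: weighted_def fun_eq_iff right_diff_distrib)
  then show ?thesis by (simp add: space_op_diff)
qed

lemma discrete_caputo_diff:
  "discrete_caputo \<tau> a (\<lambda>s. w s - w' s) j = discrete_caputo \<tau> a w j - discrete_caputo \<tau> a w' j"
proof -
  have "fwd_diff \<tau> (\<lambda>s. w s - w' s) = (\<lambda>s. fwd_diff \<tau> w s - fwd_diff \<tau> w' s)"
    by (simp add: fwd_diff_def fun_eq_iff flip: diff_divide_distrib)
  then show ?thesis
    by (simp add: discrete_caputo_def right_diff_distrib sum_subtractf diff_divide_distrib)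
qed

lemma scheme_solution_diff:
  assumes "scheme_solution l T N j0 \<alpha> k q \<sigma> \<phi> g y" "scheme_solution l T N j0 \<alpha> k q \<sigma> \<phi>' g' y'"
  shows "scheme_solution l T N j0 \<alpha> k q \<sigma> (\<lambda>s i. \<phi> s i - \<phi>' s i) (\<lambda>i. g i - g' i)
    (\<lambda>s i. y s i - y' s i)"
  using assms
  by (simp add: scheme_solution_def Let_def discrete_caputo_diff space_op_weighted_diff)

theorem theorem3:
  fixes l T c1 \<sigma> :: real
    and \<alpha> :: "real \<Rightarrow> real"
    and k q :: "real \<Rightarrow> real \<Rightarrow> real"
  assumes "0 < l" and "0 < T"
    and "continuous_on {0<..<l} \<alpha>"
    and "\<And>x. x \<in> {0<..<l} \<Longrightarrow> 0 < \<alpha> x \<and> \<alpha> x < 1"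
    and "0 < c1"
    and "\<And>x t. x \<in> {0..l} \<Longrightarrow> t \<in> {0..T} \<Longrightarrow> c1 \<le> k x t"
    and "\<And>x t. x \<in> {0..l} \<Longrightarrow> t \<in> {0..T} \<Longrightarrow> 0 \<le> q x t"
    and "0 \<le> \<sigma>" and "\<sigma> \<le> 1"
  shows
    "absolutely_stable {N. 2 \<le> N \<and> \<sigma> \<ge> 1 / (3 - 2 powr (1 - min_order l N \<alpha>))} l T \<alpha> k q c1 \<sigma> \<and>
     (\<forall>N j0. 2 \<le> N \<longrightarrow> 1 \<le> j0 \<longrightarrow> \<sigma> \<ge> 1 / (3 - 2 powr (1 - min_order l N \<alpha>)) \<longrightarrow>
       (\<forall>(f :: real \<Rightarrow> real \<Rightarrow> real) (u0 :: real \<Rightarrow> real) y.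
          let \<phi> = (\<lambda>j i. f (node (space_step l N) i) (half_after (time_step T j0) j));
              g = (\<lambda>i. u0 (node (space_step l N) i))
          in scheme_solution l T N j0 \<alpha> k q \<sigma> \<phi> g y \<longrightarrow>
             (\<forall>j<j0. apriori_estimate l T N j0 \<alpha> c1 \<sigma> \<phi> g y j)))"
proof -
  \<comment> \<open>Applied directly this bounds a solution with data from \<open>f\<close> and
    \<open>u0\<close>; applied through \<open>scheme_solution_diff\<close> it gives
    stability.\<close>
  have estimate: "apriori_estimate l T N j0 \<alpha> c1 \<sigma> \<phi> g y j"
    if "2 \<le> N" "\<sigma> \<ge> 1 / (3 - 2 powr (1 - min_order l N \<alpha>))" "j < j0"
      "scheme_solution l T N j0 \<alpha> k q \<sigma> \<phi> g y" for N j0 \<phi> g y j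
    using that assms by (intro scheme_solution_apriori[where k = k and q = q]) auto
  show ?thesis
    unfolding absolutely_stable_def stable_on_grid_def Let_def
    by (auto intro!: estimate intro: scheme_solution_diff)
qed

end
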